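(* Let $G$ be a closed ACG term. Then there is a basic ACG term $H$ such that $ACG\vdash G=H$, i.e. $G=H$ is derivable by equational logic from the axioms of ACG listed in the context.
   Context: Fix a set of atomic games $\mathcal{G}_{at}=\{g_a\}_{a\in A}$ containing a special idle atomic game $\iota=g_0$. ACG terms are built from atomic games (and variables $x,y,z,\dots$) using the binary operations $\vee$ (choice of the first player), $\wedge$ (choice of the second player), $\circ$ (composition), $\parallel$ (parallel composition) and the unary operation $^d$ (dualization); closed terms are those without variables. The axioms of ACG are the axioms of BAG together with the axioms CG1–CG11. BAG axioms (for all terms $x,y,z$): G1: $x\vee x=x$, $x\wedge x=x$; G2: $x\vee y=y\vee x$, $x\wedge y=y\wedge x$; G3: $x\vee(y\vee z)=(x\vee y)\vee z$, $x\wedge(y\wedge z)=(x\wedge y)\wedge z$; G4: $x\vee(x\wedge y)=x$, $x\wedge(x\vee y)=x$; G5: $x\vee(y\wedge z)=(x\vee y)\wedge(x\vee z)$, $x\wedge(y\vee z)=(x\wedge y)\vee(x\wedge z)$; G6: $(x^d)^d=x$; G7: $(x\vee y)^d=x^d\wedge y^d$, $(x\wedge y)^d=x^d\vee y^d$; G8: $(x\circ y)\circ z=x\circ(y\circ z)$; G9: $(x\vee y)\circ z=(x\circ z)\vee(y\circ z)$, $(x\wedge y)\circ z=(x\circ z)\wedge(y\circ z)$; G10: $x^d\circ y^d=(x\circ y)^d$; G11: $x\circ\iota=\iota\circ x=x$; G12: $\iota^d=\iota$. ACG axioms (for all terms $x,y,z$ and atomic games $g_a,g_b\in\mathcal{G}_{at}$):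 CG1: $(x\parallel y)\parallel z=x\parallel(y\parallel z)$; CG2: $g_a\parallel(g_b\circ y)=(g_a\parallel g_b)\circ y$; CG3: $(g_a\circ x)\parallel g_b=(g_a\parallel g_b)\circ x$; CG4: $(g_a\circ x)\parallel(g_b\circ y)=(g_a\parallel g_b)\circ(x\parallel y)$; CG5: $(x\vee y)\parallel z=(x\parallel z)\vee(y\parallel z)$; CG6: $x\parallel(y\vee z)=(x\parallel y)\vee(x\parallel z)$; CG7: $(x\wedge y)\parallel z=(x\parallel z)\wedge(y\parallel z)$; CG8: $x\parallel(y\wedge z)=(x\parallel y)\wedge(x\parallel z)$; CG9: $(x\parallel y)^d=x^d\parallel y^d$; CG10: $\iota\parallel x=x$; CG11: $x\parallel\iota=x$. The set $\mathcal{B}(ACG)$ of basic ACG terms is the smallest set such that: every atomic game $g_a\in\mathcal{G}_{at}$ is basic; every dual atomic game $g_a^d$ with $g_a\in\mathcal{G}_{at}$ is basic; if $g_a\in\mathcal{G}_{at}$ and $G$ is basic then $g_a\circ G$ is basic; if $G,H$ are basic then $G\vee H$, $G\wedge H$ and $G\parallel H$ are basic. *)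

theory Defs
  imports Main
begin

text \<open>
  The type \<open>'a\<close> is the index set of the atomic games and \<open>'v\<close> the set of variables.
  The index of the idle game is a parameter \<open>i\<close> of the axiom systems, so that the idle
  game is one of the atomic games.
\<close>

datatype (atoms: 'a, vars: 'v) acg_term =
    Var 'v
  | Atom 'a
  | Or "('a, 'v) acg_term" "('a, 'v) acg_term"  (infixl "\<^bold>\<or>" 65)
  | And "('a, 'v) acg_term" "('a, 'v) acg_term"  (infixl "\<^bold>\<and>" 65)
  | Comp "('a, 'v) acg_term" "('a, 'v) acg_term"  (infixl "\<^bold>\<circ>" 75)
  | Par "('a, 'v) acg_term" "('a, 'v) acg_term"  (infixl "\<^bold>\<parallel>" 70)
  | Dual "('a, 'v) acg_term"  ("_\<^sup>d" [1000] 999)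

definition closed_term :: "('a, 'v) acg_term \<Rightarrow> bool" where
  "closed_term t \<longleftrightarrow> vars t = {}"

inductive bag_axiom :: "'a \<Rightarrow> ('a, 'v) acg_term \<Rightarrow> ('a, 'v) acg_term \<Rightarrow> bool"
  for i :: 'a where
  G1_or:    "bag_axiom i (x \<^bold>\<or> x) x"
| G1_and:   "bag_axiom i (x \<^bold>\<and> x) x"
| G2_or:    "bag_axiom i (x \<^bold>\<or> y) (y \<^bold>\<or> x)"
| G2_and:   "bag_axiom i (x \<^bold>\<and> y) (y \<^bold>\<and> x)"
| G3_or:    "bag_axiom i (x \<^bold>\<or> (y \<^bold>\<or> z)) ((x \<^bold>\<or> y) \<^bold>\<or> z)"
| G3_and:   "bag_axiom i (x \<^bold>\<and> (y \<^bold>\<and> z)) ((x \<^bold>\<and> y) \<^bold>\<and> z)"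
| G4_or:    "bag_axiom i (x \<^bold>\<or> (x \<^bold>\<and> y)) x"
| G4_and:   "bag_axiom i (x \<^bold>\<and> (x \<^bold>\<or> y)) x"
| G5_or:    "bag_axiom i (x \<^bold>\<or> (y \<^bold>\<and> z)) ((x \<^bold>\<or> y) \<^bold>\<and> (x \<^bold>\<or> z))"
| G5_and:   "bag_axiom i (x \<^bold>\<and> (y \<^bold>\<or> z)) ((x \<^bold>\<and> y) \<^bold>\<or> (x \<^bold>\<and> z))"
| G6:       "bag_axiom i ((x\<^sup>d)\<^sup>d) x"
| G7_or:    "bag_axiom i ((x \<^bold>\<or> y)\<^sup>d) (x\<^sup>d \<^bold>\<and> y\<^sup>d)"
| G7_and:   "bag_axiom i ((x \<^bold>\<and> y)\<^sup>d) (x\<^sup>d \<^bold>\<or> y\<^sup>d)"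
| G8:       "bag_axiom i ((x \<^bold>\<circ> y) \<^bold>\<circ> z) (x \<^bold>\<circ> (y \<^bold>\<circ> z))"
| G9_or:    "bag_axiom i ((x \<^bold>\<or> y) \<^bold>\<circ> z) ((x \<^bold>\<circ> z) \<^bold>\<or> (y \<^bold>\<circ> z))"
| G9_and:   "bag_axiom i ((x \<^bold>\<and> y) \<^bold>\<circ> z) ((x \<^bold>\<circ> z) \<^bold>\<and> (y \<^bold>\<circ> z))"
| G10:      "bag_axiom i (x\<^sup>d \<^bold>\<circ> y\<^sup>d) ((x \<^bold>\<circ> y)\<^sup>d)"
| G11_right: "bag_axiom i (x \<^bold>\<circ> Atom i) x"
| G11_left: "bag_axiom i (Atom i \<^bold>\<circ> x) x"
| G12:      "bag_axiom i ((Atom i)\<^sup>d) (Atom i)"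

inductive acg_axiom :: "'a \<Rightarrow> ('a, 'v) acg_term \<Rightarrow> ('a, 'v) acg_term \<Rightarrow> bool"
  for i :: 'a where
  BAG:  "bag_axiom i s t \<Longrightarrow> acg_axiom i s t"
| CG1:  "acg_axiom i ((x \<^bold>\<parallel> y) \<^bold>\<parallel> z) (x \<^bold>\<parallel> (y \<^bold>\<parallel> z))"
| CG2:  "acg_axiom i (Atom a \<^bold>\<parallel> (Atom b \<^bold>\<circ> y)) ((Atom a \<^bold>\<parallel> Atom b) \<^bold>\<circ> y)"
| CG3:  "acg_axiom i ((Atom a \<^bold>\<circ> x) \<^bold>\<parallel> Atom b) ((Atom a \<^bold>\<parallel> Atom b) \<^bold>\<circ> x)"
| CG4:  "acg_axiom i ((Atom a \<^bold>\<circ> x) \<^bold>\<parallel> (Atom b \<^bold>\<circ> y)) ((Atom a \<^bold>\<parallel> Atom b) \<^bold>\<circ> (x \<^bold>\<parallel> y))"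
| CG5:  "acg_axiom i ((x \<^bold>\<or> y) \<^bold>\<parallel> z) ((x \<^bold>\<parallel> z) \<^bold>\<or> (y \<^bold>\<parallel> z))"
| CG6:  "acg_axiom i (x \<^bold>\<parallel> (y \<^bold>\<or> z)) ((x \<^bold>\<parallel> y) \<^bold>\<or> (x \<^bold>\<parallel> z))"
| CG7:  "acg_axiom i ((x \<^bold>\<and> y) \<^bold>\<parallel> z) ((x \<^bold>\<parallel> z) \<^bold>\<and> (y \<^bold>\<parallel> z))"
| CG8:  "acg_axiom i (x \<^bold>\<parallel> (y \<^bold>\<and> z)) ((x \<^bold>\<parallel> y) \<^bold>\<and> (x \<^bold>\<parallel> z))"
| CG9:  "acg_axiom i ((x \<^bold>\<parallel> y)\<^sup>d) (x\<^sup>d \<^bold>\<parallel> y\<^sup>d)"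
| CG10: "acg_axiom i (Atom i \<^bold>\<parallel> x) x"
| CG11: "acg_axiom i (x \<^bold>\<parallel> Atom i) x"

text \<open>
  Equational logic over a set of identities. There is no substitution rule: the axiom
  systems above are schematic in all terms, hence already closed under substitution.
\<close>

inductive eq_derivable ::
  "(('a, 'v) acg_term \<Rightarrow> ('a, 'v) acg_term \<Rightarrow> bool) \<Rightarrow> ('a, 'v) acg_term \<Rightarrow> ('a, 'v) acg_term \<Rightarrow> bool"
  for Ax where
  ax:        "Ax s t \<Longrightarrow> eq_derivable Ax s t"
| refl:      "eq_derivable Ax t t"
| sym:       "eq_derivable Ax s t \<Longrightarrow> eq_derivable Ax t s"
| trans:     "eq_derivable Ax s t \<Longrightarrow> eq_derivable Ax t u \<Longrightarrow> eq_derivable Ax s u"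
| cong_or:   "eq_derivable Ax s s' \<Longrightarrow> eq_derivable Ax t t' \<Longrightarrow> eq_derivable Ax (s \<^bold>\<or> t) (s' \<^bold>\<or> t')"
| cong_and:  "eq_derivable Ax s s' \<Longrightarrow> eq_derivable Ax t t' \<Longrightarrow> eq_derivable Ax (s \<^bold>\<and> t) (s' \<^bold>\<and> t')"
| cong_comp: "eq_derivable Ax s s' \<Longrightarrow> eq_derivable Ax t t' \<Longrightarrow> eq_derivable Ax (s \<^bold>\<circ> t) (s' \<^bold>\<circ> t')"
| cong_par:  "eq_derivable Ax s s' \<Longrightarrow> eq_derivable Ax t t' \<Longrightarrow> eq_derivable Ax (s \<^bold>\<parallel> t) (s' \<^bold>\<parallel> t')"
| cong_dual: "eq_derivable Ax s s' \<Longrightarrow> eq_derivable Ax (s\<^sup>d) (s'\<^sup>d)"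

inductive_set basic_acg :: "('a, 'v) acg_term set" where
  atom:      "Atom a \<in> basic_acg"
| dual_atom: "(Atom a)\<^sup>d \<in> basic_acg"
| comp:      "G \<in> basic_acg \<Longrightarrow> Atom a \<^bold>\<circ> G \<in> basic_acg"
| or:        "G \<in> basic_acg \<Longrightarrow> H \<in> basic_acg \<Longrightarrow> G \<^bold>\<or> H \<in> basic_acg"
| and_:      "G \<in> basic_acg \<Longrightarrow> H \<in> basic_acg \<Longrightarrow> G \<^bold>\<and> H \<in> basic_acg"
| par:       "G \<in> basic_acg \<Longrightarrow> H \<in> basic_acg \<Longrightarrow> G \<^bold>\<parallel> H \<in> basic_acg"

end

theory Submission
  imports Defs
begin

text \<open>
  Taking the second atomic game in CG2 to be idle gives \<open>g \<parallel> y = g \<circ> y\<close> for every atomic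
  game \<open>g\<close>. All operations preserve this property of the left argument, so parallel and
  sequential composition agree below a closed term. Hence a composition of basic terms equals
  their parallel composition, which is basic; in particular \<open>g\<^sup>d \<circ> H\<close>, which is not a basic
  term itself, equals the basic term \<open>g\<^sup>d \<parallel> H\<close>.
\<close>

abbreviation acg_eq ::
    "'a \<Rightarrow> ('a, 'v) acg_term \<Rightarrow> ('a, 'v) acg_term \<Rightarrow> bool"  ("(_/ \<turnstile> _/ \<approx> _)" [51, 51, 51] 50) where
  "i \<turnstile> s \<approx> t \<equiv> eq_derivable (acg_axiom i) s t"

declare eq_derivable.trans [trans]

text \<open>Identities inherited from BAG pass through the rule \<open>BAG\<close> while CG1 to CG11
  do not; with both routes bundled, a proof names only the axiom it uses.\<close>

lemmas acg_ax = eq_derivable.ax [OF acg_axiom.BAG] eq_derivable.ax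
lemmas acg_ax_sym = acg_ax [THEN eq_derivable.sym]
lemmas eq_cong = eq_derivable.refl eq_derivable.cong_or eq_derivable.cong_and
  eq_derivable.cong_comp eq_derivable.cong_par eq_derivable.cong_dual

lemma atom_comp_eq_par: "i \<turnstile> Atom a \<^bold>\<circ> y \<approx> Atom a \<^bold>\<parallel> y"
proof -
  \<comment> \<open>CG11 read backwards inserts the idle game as a parallel factor, so that CG2
    applies with \<open>b = i\<close>; G11 then removes it from the right operand.\<close>
  have "i \<turnstile> Atom a \<^bold>\<circ> y \<approx> (Atom a \<^bold>\<parallel> Atom i) \<^bold>\<circ> y"
    by (intro eq_cong acg_ax_sym acg_axiom.CG11)
  also have "i \<turnstile> \<dots> \<approx> Atom a \<^bold>\<parallel> (Atom i \<^bold>\<circ> y)"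
    by (intro acg_ax_sym acg_axiom.CG2)
  also have "i \<turnstile> \<dots> \<approx> Atom a \<^bold>\<parallel> y"
    by (intro eq_cong acg_ax bag_axiom.G11_left)
  finally show ?thesis .
qed

text \<open>The axioms for the two products match when the left argument is decomposed: G9 with CG5
  and CG7, G8 with CG1, G10 with CG9. Closedness excludes variables, so every leaf is an atomic
  game.\<close>

lemma closed_comp_eq_par:
  assumes "closed_term G"
  shows "i \<turnstile> G \<^bold>\<circ> y \<approx> G \<^bold>\<parallel> y"
  using assms
\<comment> \<open>The right argument must vary: composite left arguments use the hypothesis at
  \<open>H \<circ> y\<close>, dual ones at the dual of \<open>y\<close>.\<close>
proof (induction G arbitrary: y)
  case (Var v)
  then show ?case by (simp add: closed_term_def)
next
  case (Atom a)
  show ?case by (rule atom_comp_eq_par)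
next
  case (Or G H)
  then have IH: "i \<turnstile> G \<^bold>\<circ> y \<approx> G \<^bold>\<parallel> y" "i \<turnstile> H \<^bold>\<circ> y \<approx> H \<^bold>\<parallel> y"
    by (auto simp: closed_term_def)
  have "i \<turnstile> (G \<^bold>\<or> H) \<^bold>\<circ> y \<approx> (G \<^bold>\<circ> y) \<^bold>\<or> (H \<^bold>\<circ> y)"
    by (intro acg_ax bag_axiom.G9_or)
  also have "i \<turnstile> \<dots> \<approx> (G \<^bold>\<parallel> y) \<^bold>\<or> (H \<^bold>\<parallel> y)"
    by (intro eq_cong IH)
  also have "i \<turnstile> \<dots> \<approx> (G \<^bold>\<or> H) \<^bold>\<parallel> y"
    by (intro acg_ax_sym acg_axiom.CG5)
  finally show ?case .
next
  case (And G H)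
  then have IH: "i \<turnstile> G \<^bold>\<circ> y \<approx> G \<^bold>\<parallel> y" "i \<turnstile> H \<^bold>\<circ> y \<approx> H \<^bold>\<parallel> y"
    by (auto simp: closed_term_def)
  have "i \<turnstile> (G \<^bold>\<and> H) \<^bold>\<circ> y \<approx> (G \<^bold>\<circ> y) \<^bold>\<and> (H \<^bold>\<circ> y)"
    by (intro acg_ax bag_axiom.G9_and)
  also have "i \<turnstile> \<dots> \<approx> (G \<^bold>\<parallel> y) \<^bold>\<and> (H \<^bold>\<parallel> y)"
    by (intro eq_cong IH)
  also have "i \<turnstile> \<dots> \<approx> (G \<^bold>\<and> H) \<^bold>\<parallel> y"
    by (intro acg_ax_sym acg_axiom.CG7)
  finally show ?case .
next
  case (Comp G H)
  then have IH: "i \<turnstile> G \<^bold>\<circ> z \<approx> G \<^bold>\<parallel> z" "i \<turnstile> H \<^bold>\<circ> z \<approx> H \<^bold>\<parallel> z" for z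
    by (auto simp: closed_term_def)
  have "i \<turnstile> G \<^bold>\<circ> H \<^bold>\<circ> y \<approx> G \<^bold>\<circ> (H \<^bold>\<circ> y)"
    by (intro acg_ax bag_axiom.G8)
  also have "i \<turnstile> \<dots> \<approx> G \<^bold>\<parallel> (H \<^bold>\<circ> y)"
    by (rule IH)
  also have "i \<turnstile> \<dots> \<approx> G \<^bold>\<parallel> (H \<^bold>\<parallel> y)"
    by (intro eq_cong IH)
  also have "i \<turnstile> \<dots> \<approx> G \<^bold>\<parallel> H \<^bold>\<parallel> y"
    by (intro acg_ax_sym acg_axiom.CG1)
  \<comment> \<open>The hypothesis for \<open>G\<close>, read backwards at \<open>z = H\<close>,
    restores the composition inside the left factor.\<close>
  also have "i \<turnstile> \<dots> \<approx> (G \<^bold>\<circ> H) \<^bold>\<parallel> y"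
    by (intro eq_cong IH [THEN eq_derivable.sym])
  finally show ?case .
next
  case (Par G H)
  then have IH: "i \<turnstile> G \<^bold>\<circ> z \<approx> G \<^bold>\<parallel> z" "i \<turnstile> H \<^bold>\<circ> z \<approx> H \<^bold>\<parallel> z" for z
    by (auto simp: closed_term_def)
  \<comment> \<open>Rewriting the left factor as a composition makes G8 applicable; the rest follows
    the previous case.\<close>
  have "i \<turnstile> (G \<^bold>\<parallel> H) \<^bold>\<circ> y \<approx> G \<^bold>\<circ> H \<^bold>\<circ> y"
    by (intro eq_cong IH [THEN eq_derivable.sym])
  also have "i \<turnstile> \<dots> \<approx> G \<^bold>\<circ> (H \<^bold>\<circ> y)"
    by (intro acg_ax bag_axiom.G8)
  also have "i \<turnstile> \<dots> \<approx> G \<^bold>\<parallel> (H \<^bold>\<circ> y)"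
    by (rule IH)
  also have "i \<turnstile> \<dots> \<approx> G \<^bold>\<parallel> (H \<^bold>\<parallel> y)"
    by (intro eq_cong IH)
  also have "i \<turnstile> \<dots> \<approx> G \<^bold>\<parallel> H \<^bold>\<parallel> y"
    by (intro acg_ax_sym acg_axiom.CG1)
  finally show ?case .
next
  case (Dual G)
  then have IH: "i \<turnstile> G \<^bold>\<circ> z \<approx> G \<^bold>\<parallel> z" for z
    by (auto simp: closed_term_def)
  \<comment> \<open>G10 needs duals on both sides, so \<open>y\<close> is first written as a double
    dual.\<close>
  have "i \<turnstile> G\<^sup>d \<^bold>\<circ> y \<approx> G\<^sup>d \<^bold>\<circ> (y\<^sup>d)\<^sup>d"
    by (intro eq_cong acg_ax_sym bag_axiom.G6)
  also have "i \<turnstile> \<dots> \<approx> (G \<^bold>\<circ> y\<^sup>d)\<^sup>d"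
    by (intro acg_ax bag_axiom.G10)
  also have "i \<turnstile> \<dots> \<approx> (G \<^bold>\<parallel> y\<^sup>d)\<^sup>d"
    by (intro eq_cong IH)
  also have "i \<turnstile> \<dots> \<approx> G\<^sup>d \<^bold>\<parallel> (y\<^sup>d)\<^sup>d"
    by (intro acg_ax acg_axiom.CG9)
  also have "i \<turnstile> \<dots> \<approx> G\<^sup>d \<^bold>\<parallel> y"
    by (intro eq_cong acg_ax bag_axiom.G6)
  finally show ?case .
qed

text \<open>Duality is pushed inwards by G7 and CG9 until it meets atomic games, where at most one
  dual survives by G6.\<close>

lemma dual_basic:
  assumes "G \<in> basic_acg"
  shows "\<exists>H \<in> basic_acg. i \<turnstile> G\<^sup>d \<approx> H"
  using assms
proof induction
  case (atom a)
  show ?case by (blast intro: basic_acg.dual_atom eq_derivable.refl)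
next
  case (dual_atom a)
  show ?case by (intro bexI [of _ "Atom a"] basic_acg.atom acg_ax bag_axiom.G6)
next
  case (comp G a)
  then obtain H where H: "H \<in> basic_acg" "i \<turnstile> G\<^sup>d \<approx> H" by blast
  \<comment> \<open>Pushing the dual through the composition by G10 would leave a dual atomic game
    composed with \<open>H\<close>, which is not basic; passing to the parallel form first avoids
    this.\<close>
  have "i \<turnstile> (Atom a \<^bold>\<circ> G)\<^sup>d \<approx> (Atom a \<^bold>\<parallel> G)\<^sup>d"
    by (intro eq_cong atom_comp_eq_par)
  also have "i \<turnstile> \<dots> \<approx> (Atom a)\<^sup>d \<^bold>\<parallel> G\<^sup>d"
    by (intro acg_ax acg_axiom.CG9)
  also have "i \<turnstile> \<dots> \<approx> (Atom a)\<^sup>d \<^bold>\<parallel> H"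
    by (intro eq_cong H)
  finally show ?case using H by (blast intro: basic_acg.intros)
next
  case (or G1 G2)
  then obtain H1 H2 where H: "H1 \<in> basic_acg" "H2 \<in> basic_acg" "i \<turnstile> G1\<^sup>d \<approx> H1" "i \<turnstile> G2\<^sup>d \<approx> H2"
    by blast
  have "i \<turnstile> (G1 \<^bold>\<or> G2)\<^sup>d \<approx> G1\<^sup>d \<^bold>\<and> G2\<^sup>d"
    by (intro acg_ax bag_axiom.G7_or)
  also have "i \<turnstile> \<dots> \<approx> H1 \<^bold>\<and> H2"
    by (intro eq_cong H)
  finally show ?case using H by (blast intro: basic_acg.intros)
next
  case (and_ G1 G2)
  then obtain H1 H2 where H: "H1 \<in> basic_acg" "H2 \<in> basic_acg" "i \<turnstile> G1\<^sup>d \<approx> H1" "i \<turnstile> G2\<^sup>d \<approx> H2"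
    by blast
  have "i \<turnstile> (G1 \<^bold>\<and> G2)\<^sup>d \<approx> G1\<^sup>d \<^bold>\<or> G2\<^sup>d"
    by (intro acg_ax bag_axiom.G7_and)
  also have "i \<turnstile> \<dots> \<approx> H1 \<^bold>\<or> H2"
    by (intro eq_cong H)
  finally show ?case using H by (blast intro: basic_acg.intros)
next
  case (par G1 G2)
  then obtain H1 H2 where H: "H1 \<in> basic_acg" "H2 \<in> basic_acg" "i \<turnstile> G1\<^sup>d \<approx> H1" "i \<turnstile> G2\<^sup>d \<approx> H2"
    by blast
  have "i \<turnstile> (G1 \<^bold>\<parallel> G2)\<^sup>d \<approx> G1\<^sup>d \<^bold>\<parallel> G2\<^sup>d"
    by (intro acg_ax acg_axiom.CG9)
  also have "i \<turnstile> \<dots> \<approx> H1 \<^bold>\<parallel> H2"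
    by (intro eq_cong H)
  finally show ?case using H by (blast intro: basic_acg.intros)
qed

theorem mainTheorem2:
  fixes i :: 'a and G :: "('a, 'v) acg_term"
  assumes "closed_term G"
  shows "\<exists>H \<in> basic_acg. eq_derivable (acg_axiom i) G H"
  using assms
proof (induction G)
  case (Var v)
  then show ?case by (simp add: closed_term_def)
next
  case (Atom a)
  show ?case by (blast intro: basic_acg.atom eq_derivable.refl)
next
  case (Or G1 G2)
  then obtain H1 H2 where "H1 \<in> basic_acg" "H2 \<in> basic_acg" "i \<turnstile> G1 \<approx> H1" "i \<turnstile> G2 \<approx> H2"
    by (auto simp: closed_term_def)
  then show ?case by (blast intro: basic_acg.or eq_derivable.cong_or)
next
  case (And G1 G2)
  then obtain H1 H2 where "H1 \<in> basic_acg" "H2 \<in> basic_acg" "i \<turnstile> G1 \<approx> H1" "i \<turnstile> G2 \<approx> H2"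
    by (auto simp: closed_term_def)
  then show ?case by (blast intro: basic_acg.and_ eq_derivable.cong_and)
next
  case (Comp G1 G2)
  then obtain H1 H2 where H: "H1 \<in> basic_acg" "H2 \<in> basic_acg" "i \<turnstile> G1 \<approx> H1" "i \<turnstile> G2 \<approx> H2"
    by (auto simp: closed_term_def)
  \<comment> \<open>The composition is replaced before the factors are normalized, because
    closedness of \<open>G1\<close> is directly available from the premise.\<close>
  have "i \<turnstile> G1 \<^bold>\<circ> G2 \<approx> G1 \<^bold>\<parallel> G2"
    using Comp.prems by (intro closed_comp_eq_par) (simp add: closed_term_def)
  also have "i \<turnstile> \<dots> \<approx> H1 \<^bold>\<parallel> H2"
    by (intro eq_cong H)
  finally show ?case using H by (blast intro: basic_acg.par)
next
  case (Par G1 G2)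
  then obtain H1 H2 where "H1 \<in> basic_acg" "H2 \<in> basic_acg" "i \<turnstile> G1 \<approx> H1" "i \<turnstile> G2 \<approx> H2"
    by (auto simp: closed_term_def)
  then show ?case by (blast intro: basic_acg.par eq_derivable.cong_par)
next
  case (Dual G)
  then obtain K where K: "K \<in> basic_acg" "i \<turnstile> G \<approx> K"
    by (auto simp: closed_term_def)
  \<comment> \<open>The dual of the basic term \<open>K\<close> need not be basic, so a second
    normalization is required.\<close>
  obtain H where H: "H \<in> basic_acg" "i \<turnstile> K\<^sup>d \<approx> H"
    using dual_basic [OF K(1)] by blast
  have "i \<turnstile> G\<^sup>d \<approx> K\<^sup>d"
    by (intro eq_cong K)
  also note H(2)
  finally show ?case using H(1) by blast
qed

end
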